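(* Let $T=(K,L,R)$ with $L=(1,-1)$, and let $(b_T(n))_{n\in\mathbb N_0}$ be any sequence associated with $T$. Assume $\deg K=m$ and let $n_0\in\mathbb N_0$ be the smallest number such that $k_{n+1}-k_n=m$ for every $n\ge n_0$. If $u<k_{n+1}-k_n$ for every $n\ge n_0-1$, then for all integers $n\ge n_0$ and $q\in\{0,\dots,m-1\}$, $$b_T(k_{k_n+q})\equiv b_T(k_{k_{n_0}-1})+b_T(k_{n_0-1})\sum_{i=1}^{u}ir_i+b_T(k_n)\sum_{i=0}^{q}(q-i+1)r_i+b_T(k_{n-1})\sum_{i=q+1}^{u}(q-i+1)r_i\pmod m.$$
   Context: Let $K=(k_n)_{n\in\mathbb N_0}$ be a strictly increasing sequence of non-negative integers with $k_0=0$; set $k_{-n}=-n$ for $n\in\mathbb N$. Let $R=(r_0,\dots,r_u)$ be a finite sequence of integers, $L=(1,-1)$ and $T=(K,L,R)$. A sequence of integers $(b_T(n))_{n\in\mathbb N_0}$, extended by $b_T(q)=0$ for negative integers $q$, is associated with $T$ if for every $n\in\mathbb N_0$: (a) $b_T(k_n)=b_T(k_n+1)=\dots=b_T(k_{n+1}-1)$, and (b) $b_T(k_n)-b_T(k_{n-1})=\sum_{j=0}^{u}r_jb_T(n-j)$. $\deg K=m$ means that $k_n-k_{n-1}=m$ for infinitely many $n$, while only finitely many $n$ have $k_n-k_{n-1}\ne m$. Empty sums are $0$. *)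

theory Defs
  imports Main "HOL-Library.More_List" "HOL-Number_Theory.Cong"
begin

text \<open>
  The sequence \<open>K\<close> is extended to all integer indices by \<open>k (-n) = -n\<close>, and the sequence \<open>b\<close>
  by zero. The finite sequence \<open>R = (r 0, ..., r u)\<close> is a list of length \<open>u + 1\<close>.
\<close>

definition index_seq :: "(nat \<Rightarrow> nat) \<Rightarrow> bool" where
  "index_seq K \<longleftrightarrow> strict_mono K \<and> K 0 = 0"

definition kext :: "(nat \<Rightarrow> nat) \<Rightarrow> int \<Rightarrow> int" where
  "kext K n = (if n < 0 then n else int (K (nat n)))"

definition bext :: "(nat \<Rightarrow> int) \<Rightarrow> int \<Rightarrow> int" where
  "bext b n = (if n < 0 then 0 else b (nat n))"

text \<open>
  Association with \<open>(K, L, R)\<close> for the fixed \<open>L = (1, -1)\<close>, which is the source of the two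
  coefficients on the left-hand side of the recurrence.
\<close>

definition associated :: "(nat \<Rightarrow> nat) \<Rightarrow> int list \<Rightarrow> (nat \<Rightarrow> int) \<Rightarrow> bool" where
  "associated K R b \<longleftrightarrow>
     (\<forall>n. (\<forall>j\<in>{K n..<K (Suc n)}. b j = b (K n)) \<and>
          bext b (kext K (int n)) - bext b (kext K (int n - 1)) =
            (\<Sum>j<length R. R ! j * bext b (int n - int j)))"

definition has_deg :: "(nat \<Rightarrow> nat) \<Rightarrow> nat \<Rightarrow> bool" where
  "has_deg K m \<longleftrightarrow>
     infinite {n::nat. kext K (int n) - kext K (int n - 1) = int m} \<and>
     finite {n::nat. kext K (int n) - kext K (int n - 1) \<noteq> int m}"

end

theory Submission imports Defs begin

text \<open>
  Write \<open>c n = b (k n)\<close>. For \<open>n \<ge> n\<^sub>0\<close> the gap conditions force every value of \<open>b\<close> occurring in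
  the recurrence at the indices \<open>k n, ..., k n + m - 1\<close> to be \<open>c n\<close> or \<open>c (n - 1)\<close>, so summing the
  recurrence over an initial part of the block gives an exact formula for \<open>c (k n + q)\<close> in terms
  of \<open>c (k n - 1)\<close>, \<open>c n\<close> and \<open>c (n - 1)\<close>. Over the whole block it shows that
  \<open>c (k n - 1) + c (n - 1) * (\<Sum>i. i * r i)\<close> is invariant modulo \<open>m\<close> under \<open>n \<mapsto> n + 1\<close>.
\<close>

text \<open>The finitely many exceptional gaps are bounded, so some threshold qualifies and
  \<open>LEAST\<close> attains one.\<close>

lemma has_deg_Least:
  assumes "has_deg K m"
    and "n\<^sub>0 = (LEAST N. \<forall>n\<ge>N. kext K (int n + 1) - kext K (int n) = int m)"
    and "int n\<^sub>0 \<le> n"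
  shows "kext K (n + 1) = kext K n + int m"
proof -
  let ?P = "\<lambda>N. \<forall>n\<ge>N. kext K (int n + 1) - kext K (int n) = int m"
  from assms(1) obtain M where M: "\<forall>n\<in>{n. kext K (int n) - kext K (int n - 1) \<noteq> int m}. n \<le> M"
    unfolding has_deg_def finite_nat_set_iff_bounded_le by blast
  have "?P M"
  proof (intro allI impI)
    fix n assume "M \<le> n"
    \<comment> \<open>\<open>has_deg\<close> indexes a gap by its right end and the threshold by its
      left end, hence the shift to \<open>Suc n\<close>.\<close>
    with M have "kext K (int (Suc n)) - kext K (int (Suc n) - 1) = int m"
      by (metis (mono_tags, lifting) mem_Collect_eq not_less_eq_eq)
    then show "kext K (int n + 1) - kext K (int n) = int m"
      by (simp add: add.commute)
  qed
  then have "?P n\<^sub>0"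
    unfolding assms(2) by (rule LeastI)
  moreover have "n\<^sub>0 \<le> nat n" "int (nat n) = n"
    using assms(3) by auto
  ultimately show ?thesis
    by force
qed

lemma bext_block:
  assumes "index_seq K" "associated K R b" "kext K n \<le> j" "j < kext K (n + 1)"
  shows "bext b j = bext b (kext K n)"
proof (cases "n < 0")
  case True
  \<comment> \<open>Blocks at negative indices are singletons; \<open>n = -1\<close> is separate
    because its right end is \<open>K 0 = 0\<close>.\<close>
  then have "j = n"
    using assms(1,3,4) by (cases "n = -1") (auto simp: kext_def index_seq_def)
  with True show ?thesis
    by (simp add: kext_def)
next
  case False
  then have "nat (n + 1) = Suc (nat n)"
    by simp
  with False assms(3,4) have "nat j \<in> {K (nat n)..<K (Suc (nat n))}" and "0 \<le> j"
    by (auto simp: kext_def)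
  with False assms(2) show ?thesis
    by (simp add: associated_def bext_def kext_def)
qed

text \<open>\<open>nth_default\<close> makes the coefficients vanish beyond \<open>u\<close>, so
  later sums may run past the end of \<open>R\<close>.\<close>

lemma associated_step:
  assumes "associated K R b" "length R = Suc u" "0 \<le> N"
  shows "bext b (kext K N) = bext b (kext K (N - 1))
           + (\<Sum>j\<le>u. nth_default 0 R j * bext b (N - int j))"
proof -
  have "bext b (kext K N) - bext b (kext K (N - 1)) = (\<Sum>j<length R. R ! j * bext b (N - int j))"
    using assms(1)[unfolded associated_def, rule_format, of "nat N"] assms(3) by simp
  also have "\<dots> = (\<Sum>j\<le>u. nth_default 0 R j * bext b (N - int j))"
    using assms(2) by (intro sum.cong) (auto simp: nth_default_def)
  finally show ?thesis
    by simp
qed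

text \<open>
  The natural number subtraction \<open>Q - j\<close> is truncated on purpose: \<open>Q - j\<close> and \<open>min j Q\<close> count how
  often the \<open>j\<close>-th summand of the recurrence reads \<open>b\<close> in the current and in the previous block.
\<close>

lemma partial_block_sum:
  assumes K: "index_seq K" and b: "associated K R b" and R: "length R = Suc u"
    and "0 \<le> n" and gap: "int u < kext K n - kext K (n - 1)"
    and "int Q \<le> kext K (n + 1) - kext K n"
  shows "bext b (kext K (kext K n - 1 + int Q)) =
           bext b (kext K (kext K n - 1))
           + (\<Sum>j\<le>u. nth_default 0 R j
                * (bext b (kext K n) * int (Q - j) + bext b (kext K (n - 1)) * int (min j Q)))"
  using assms(6)
proof (induction Q)
  case 0
  then show ?case by simp
next
  case (Suc Q)
  let ?c = "bext b (kext K n)" and ?c' = "bext b (kext K (n - 1))"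
  let ?N = "kext K n + int Q"
  have "0 \<le> ?N"
    using \<open>0 \<le> n\<close> by (simp add: kext_def)
  \<comment> \<open>Lags \<open>j \<le> Q\<close> stay in block \<open>n\<close>. Larger ones reach
    back less than the length of the previous block, since \<open>j \<le> u\<close>.\<close>
  have "bext b (?N - int j) = (if j \<le> Q then ?c else ?c')" if "j \<le> u" for j
  proof (cases "j \<le> Q")
    case True
    then show ?thesis
      using bext_block[OF K b, of n "?N - int j"] Suc.prems by simp
  next
    case False
    then show ?thesis
      using bext_block[OF K b, of "n - 1" "?N - int j"] gap that by simp
  qed
  then have "(\<Sum>j\<le>u. nth_default 0 R j * bext b (?N - int j))
      = (\<Sum>j\<le>u. nth_default 0 R j * (if j \<le> Q then ?c else ?c'))"
    by (intro sum.cong) auto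
  with associated_step[OF b R \<open>0 \<le> ?N\<close>]
  have "bext b (kext K ?N) = bext b (kext K (?N - 1))
      + (\<Sum>j\<le>u. nth_default 0 R j * (if j \<le> Q then ?c else ?c'))"
    by simp
  also have "bext b (kext K (?N - 1)) = bext b (kext K (kext K n - 1))
      + (\<Sum>j\<le>u. nth_default 0 R j * (?c * int (Q - j) + ?c' * int (min j Q)))"
    using Suc by (simp add: algebra_simps)
  \<comment> \<open>For \<open>j \<le> Q\<close> only \<open>Q - j\<close> grows by one; for
    \<open>j > Q\<close> it stays zero and only \<open>min j Q\<close> grows.\<close>
  also have "\<dots> + (\<Sum>j\<le>u. nth_default 0 R j * (if j \<le> Q then ?c else ?c'))
      = bext b (kext K (kext K n - 1))
      + (\<Sum>j\<le>u. nth_default 0 R j * (?c * int (Suc Q - j) + ?c' * int (min j (Suc Q))))"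
    unfolding add.assoc sum.distrib[symmetric]
    by (intro arg_cong2[where f = "(+)"] refl sum.cong)
      (auto simp: algebra_simps Suc_diff_le min_def not_less_eq_eq)
  finally show ?case
    by (simp add: algebra_simps)
qed

text \<open>For \<open>j > q\<close> the weight of \<open>y\<close> is
  \<open>q + 1 = j + (q - j + 1)\<close>: every \<open>j\<close> thus contributes to the first sum,
  and the third holds the negative corrections.\<close>

lemma sum_truncated_weights:
  fixes r :: "nat \<Rightarrow> int"
  assumes "\<And>i. u < i \<Longrightarrow> r i = 0"
  shows "(\<Sum>j\<le>u. r j * (x * int (Suc q - j) + y * int (min j (Suc q)))) =
           y * (\<Sum>i=1..u. int i * r i)
           + x * (\<Sum>i=0..q. (int q - int i + 1) * r i)
           + y * (\<Sum>i=q+1..u. (int q - int i + 1) * r i)"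
proof -
  have "(\<Sum>i=0..q. (int q - int i + 1) * r i)
      = (\<Sum>j\<le>u. if j \<le> q then (int q - int j + 1) * r j else 0)"
    by (rule sum.mono_neutral_cong) (auto simp: assms)
  moreover have "(\<Sum>i=q+1..u. (int q - int i + 1) * r i)
      = (\<Sum>j\<le>u. if j \<le> q then 0 else (int q - int j + 1) * r j)"
    by (rule sum.mono_neutral_cong) auto
  moreover have "(\<Sum>i=1..u. int i * r i) = (\<Sum>j\<le>u. int j * r j)"
    by (rule sum.mono_neutral_left) auto
  moreover have "r j * (x * int (Suc q - j) + y * int (min j (Suc q))) = y * (int j * r j)
      + x * (if j \<le> q then (int q - int j + 1) * r j else 0)
      + y * (if j \<le> q then 0 else (int q - int j + 1) * r j)" for j
    by (cases "j \<le> q") (auto simp: algebra_simps of_nat_diff)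
  ultimately show ?thesis
    by (simp only: sum_distrib_left sum.distrib)
qed

theorem theorem10:
  fixes K :: "nat \<Rightarrow> nat" and R :: "int list" and b :: "nat \<Rightarrow> int" and u m n\<^sub>0 :: nat
    and r :: "nat \<Rightarrow> int"
  assumes "index_seq K"
    and "length R = Suc u"
    and "associated K R b"
    and "has_deg K m"
    and "n\<^sub>0 = (LEAST N. \<forall>n\<ge>N. kext K (int n + 1) - kext K (int n) = int m)"
    and "\<forall>n\<ge>int n\<^sub>0 - 1. int u < kext K (n + 1) - kext K n"
  defines "r \<equiv> nth_default 0 R"
  shows "\<forall>n\<ge>n\<^sub>0. \<forall>q\<in>{0..<m}.
    [bext b (kext K (kext K (int n) + int q)) =
       bext b (kext K (kext K (int n\<^sub>0) - 1))
       + bext b (kext K (int n\<^sub>0 - 1)) * (\<Sum>i=1..u. int i * r i)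
       + bext b (kext K (int n)) * (\<Sum>i=0..q. (int q - int i + 1) * r i)
       + bext b (kext K (int n - 1)) * (\<Sum>i=q+1..u. (int q - int i + 1) * r i)] (mod int m)"
proof -
  define c where "c n = bext b (kext K n)" for n
  define S where "S = (\<Sum>i=1..u. int i * r i)"
  have gap: "kext K (n + 1) = kext K n + int m" if "int n\<^sub>0 \<le> n" for n
    using has_deg_Least[OF assms(4,5) that] .
  have r0: "r i = 0" if "u < i" for i
    using that assms(2) by (simp add: r_def nth_default_def)
  have "u < m"
    using assms(6)[rule_format, of "int n\<^sub>0"] gap[of "int n\<^sub>0"] by simp
  have block: "c (kext K (int n) + int q) = c (kext K (int n) - 1)
      + c (int n - 1) * S
      + c (int n) * (\<Sum>i=0..q. (int q - int i + 1) * r i)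
      + c (int n - 1) * (\<Sum>i=q+1..u. (int q - int i + 1) * r i)"
    if "n\<^sub>0 \<le> n" "q < m" for n q
  proof -
    \<comment> \<open>For \<open>n = n\<^sub>0\<close> this is the gap bound at
      \<open>n\<^sub>0 - 1\<close>, the block before the regular ones.\<close>
    have "int u < kext K (int n) - kext K (int n - 1)"
      using assms(6)[rule_format, of "int n - 1"] that by simp
    moreover have "int (Suc q) \<le> kext K (int n + 1) - kext K (int n)"
      using gap[of "int n"] that by simp
    ultimately show ?thesis
      using partial_block_sum[OF assms(1,3,2), of "int n" "Suc q", folded r_def]
        sum_truncated_weights[of u r "c (int n)" q "c (int n - 1)"] r0
      by (simp only: c_def S_def) (simp add: algebra_simps)
  qed
  have inv: "[c (kext K (int n) - 1) + c (int n - 1) * S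
      = c (kext K (int n\<^sub>0) - 1) + c (int n\<^sub>0 - 1) * S] (mod int m)" if "n\<^sub>0 \<le> n" for n
    using that
  proof (induction n rule: dec_induct)
    case base
    show ?case by (rule cong_refl)
  next
    case (step n)
    \<comment> \<open>At the block's last position \<open>q = m - 1\<close> the weights are
      \<open>m - i\<close>, so modulo \<open>m\<close> the sum becomes \<open>- S\<close>.\<close>
    have "(\<Sum>i=0..m-1. (int (m - 1) - int i + 1) * r i) = (\<Sum>i=0..m-1. int m * r i - int i * r i)"
      using \<open>u < m\<close> by (intro sum.cong) (auto simp: algebra_simps of_nat_diff)
    also have "\<dots> = int m * (\<Sum>i=0..m-1. r i) - (\<Sum>i=0..m-1. int i * r i)"
      by (simp add: sum_subtractf sum_distrib_left)
    also have "(\<Sum>i=0..m-1. int i * r i) = S"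
      unfolding S_def using \<open>u < m\<close> by (intro sum.mono_neutral_right) (auto simp: r0)
    finally have W: "(\<Sum>i=0..m-1. (int (m - 1) - int i + 1) * r i) = int m * (\<Sum>i=0..m-1. r i) - S" .
    have "n\<^sub>0 \<le> n" "m - 1 < m"
      using step.hyps \<open>u < m\<close> by auto
    \<comment> \<open>The sum over \<open>i = m..u\<close> is empty because
      \<open>u < m\<close>.\<close>
    from block[OF this, unfolded W]
    have "c (kext K (int n) + int (m - 1)) + c (int n) * S
        = c (kext K (int n) - 1) + c (int n - 1) * S + int m * (c (int n) * (\<Sum>i=0..m-1. r i))"
      using \<open>u < m\<close> by (simp add: algebra_simps)
    also have "kext K (int n) + int (m - 1) = kext K (int (Suc n)) - 1"
      using gap[of "int n"] step.hyps \<open>u < m\<close> by (simp add: add.commute of_nat_diff)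
    finally have "[c (kext K (int (Suc n)) - 1) + c (int (Suc n) - 1) * S
        = c (kext K (int n) - 1) + c (int n - 1) * S] (mod int m)"
      by (simp add: cong_def)
    with step.IH show ?case
      by (rule cong_trans[rotated])
  qed
  show ?thesis
    unfolding c_def[symmetric] S_def[symmetric]
  proof (intro allI impI ballI)
    fix n q assume "n\<^sub>0 \<le> n" "q \<in> {0..<m}"
    then have "q < m"
      by simp
    show "[c (kext K (int n) + int q) =
        c (kext K (int n\<^sub>0) - 1) + c (int n\<^sub>0 - 1) * S
        + c (int n) * (\<Sum>i=0..q. (int q - int i + 1) * r i)
        + c (int n - 1) * (\<Sum>i=q+1..u. (int q - int i + 1) * r i)] (mod int m)"
      \<comment> \<open>\<open>block\<close> is an exact equation; the congruence enters only
        through \<open>inv\<close>, which carries the first two terms back to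
        \<open>n\<^sub>0\<close>.\<close>
      unfolding block[OF \<open>n\<^sub>0 \<le> n\<close> \<open>q < m\<close>]
      by (intro cong_add inv[OF \<open>n\<^sub>0 \<le> n\<close>] cong_refl)
  qed
qed

end
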